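(* Let $\mathbb{F}\in\{\mathbb{R},\mathbb{C}\}$ and let $\mathcal{A}=\{A_1,\ldots,A_K\}$ be a collection of matrices in $\mathbb{M}(n,\mathbb{F})$. Then the following are equivalent: (i) for every nonzero rank-deficient matrix $Z\in\mathbb{M}(n,\mathbb{F})$ one has $\lim_{Q\to Z,\ Q\in GL(n,\mathbb{F})} f_{\mathcal{A}}(Q)=\infty$; (ii) the matrices $A_1,\ldots,A_K$ have no common nontrivial invariant subspace.
   Context: $\mathbb{M}(n,\mathbb{F})$ is the set of $n\times n$ matrices over $\mathbb{F}$ and $GL(n,\mathbb{F})$ its subset of invertible matrices. For $\mathcal{A}=\{A_1,\ldots,A_K\}\subset\mathbb{M}(n,\mathbb{F})$, the functional $f_{\mathcal{A}}:GL(n,\mathbb{F})\to[0,\infty)$ is $$f_{\mathcal{A}}(Q)=\frac12\sum_{k=1}^K\sum_{i\neq j}\left|(Q^{-1}A_kQ)_{ij}\right|^2.$$ A matrix is rank-deficient if its rank is less than $n$. A linear subspace $\mathcal{M}\subseteq\mathbb{F}^n$ is invariant for $A$ if $A(\mathcal{M})\subseteq\mathcal{M}$; it is nontrivial if it is neither $\{0\}$ nor $\mathbb{F}^n$. A common invariant subspace of several matrices is a subspace invariant for each of them. *)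

theory Defs
  imports "HOL-Analysis.Analysis"
begin

text \<open>The collection $A_1,\ldots,A_K$ is the family \<open>A\<close> restricted to the indices \<open>1,\<dots>,K\<close>.
  The value is meaningful only for invertible \<open>Q\<close>.\<close>

definition offdiag_energy ::
    "(nat \<Rightarrow> 'a::real_normed_field^'n^'n) \<Rightarrow> nat \<Rightarrow> 'a^'n^'n \<Rightarrow> real" where
  "offdiag_energy A K Q =
     (1/2) * (\<Sum>k=1..K. \<Sum>i\<in>UNIV. \<Sum>j\<in>UNIV - {i}.
        (norm ((matrix_inv Q ** A k ** Q) $ i $ j))\<^sup>2)"

definition GL :: "('a::field^'n^'n) set" where
  "GL = {Q. invertible Q}"

definition rank_deficient :: "'a::field^'n^'n \<Rightarrow> bool" where
  "rank_deficient Z \<longleftrightarrow> rank Z < CARD('n)"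

text \<open>\<open>vec.subspace\<close> is closure under the \<open>'a\<close>-scalar multiplication \<open>*s\<close>, hence over the
  complex numbers a complex subspace; the unqualified \<open>subspace\<close> would be real.\<close>

definition invariant_subspace :: "'a::field^'n^'n \<Rightarrow> ('a^'n) set \<Rightarrow> bool" where
  "invariant_subspace B M \<longleftrightarrow> vec.subspace M \<and> (\<lambda>x. B *v x) ` M \<subseteq> M"

definition nontrivial_subspace :: "('a::field^'n) set \<Rightarrow> bool" where
  "nontrivial_subspace M \<longleftrightarrow> vec.subspace M \<and> M \<noteq> {0} \<and> M \<noteq> UNIV"

end

theory Submission
  imports Defs
begin

text \<open>
  Everything is proved once, for a normed field with the Heine--Borel property, and then
  specialised to the real and the complex numbers.

  Suppose the energy does not blow up at a nonzero singular \<open>Z\<close>. Then some invertible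
  \<open>Q\<^sub>m \<longlonglongrightarrow> Z\<close> keep the off-diagonal entries of \<open>X\<^sub>m = Q\<^sub>m\<inverse> A\<^sub>k Q\<^sub>m\<close> bounded, for
  every \<open>k\<close>. The claim is that the column space of \<open>Z\<close>, which is nontrivial, is invariant
  under every \<open>A\<^sub>k\<close>. The \<open>j\<close>-th column of \<open>A\<^sub>k Q\<^sub>m = Q\<^sub>m X\<^sub>m\<close> writes \<open>A\<^sub>k q\<^sub>j\<close> as a combination
  of the columns of \<open>Q\<^sub>m\<close> whose coefficients are bounded except perhaps the diagonal one, the
  coefficient of \<open>q\<^sub>j\<close>. If the \<open>j\<close>-th column of \<open>Z\<close> is nonzero, one can solve for that
  coefficient in a row where \<open>q\<^sub>j\<close> stays away from \<open>0\<close>, so it is bounded too; a convergent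
  subsequence of the coefficients then exhibits \<open>A\<^sub>k z\<^sub>j\<close> as a combination of the columns of
  \<open>Z\<close> (lemma \<open>limit_of_bounded_conjugates\<close>). If the \<open>j\<close>-th column of \<open>Z\<close> is zero there is
  nothing to show.

  Conversely, let \<open>M\<close> be a common nontrivial invariant subspace. In a basis \<open>P\<close> adapted to \<open>M\<close>
  all \<open>A\<^sub>k\<close> are block triangular, and scaling the basis vectors outside \<open>M\<close> by \<open>t\<close> multiplies
  the surviving off-diagonal block by \<open>t\<close> and leaves the diagonal blocks alone. So the energy
  never exceeds its value at \<open>P\<close> as \<open>t \<rightarrow> 0\<close>, while the scaled basis matrix tends to a nonzero
  singular matrix with column space \<open>M\<close>.
\<close>

section \<open>Conjugation and rank\<close>

lemma rank_deficient_iff_not_invertible: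
  fixes Z :: "'a::field^'n^'n"
  shows "rank_deficient Z \<longleftrightarrow> \<not> invertible Z"
proof -
  have "invertible Z \<longleftrightarrow> vec.dim (rows Z) = CARD('n)"
    unfolding invertible_left_inverse matrix_left_invertible_span_rows_gen
    by (metis vec.dim_eq_full vec.dimension_def card_cart_basis)
  moreover have "vec.dim (rows Z) \<le> CARD('n)"
    by (metis vec.dim_subset_UNIV vec.dimension_def card_cart_basis)
  ultimately show ?thesis
    by (auto simp: rank_deficient_def row_rank_def_gen)
qed

lemma matrix_mul_conjugate:
  fixes Q :: "'a::field^'n^'n"
  assumes "invertible Q"
  shows "Q ** (matrix_inv Q ** A ** Q) = A ** Q"
proof -
  have "Q ** matrix_inv Q = mat 1"
    using assms someI_ex[of "\<lambda>Q'. Q ** Q' = mat 1 \<and> Q' ** Q = mat 1"]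
    by (auto simp: invertible_def matrix_inv_def)
  then show ?thesis
    by (simp add: matrix_mul_assoc)
qed

lemma matrix_matrix_mult_component:
  "(A ** B) $ i $ j = (\<Sum>k\<in>UNIV. A $ i $ k * B $ k $ j)"
  by (simp add: matrix_matrix_mult_def)

lemma offdiag_entry_le_energy:
  fixes A :: "nat \<Rightarrow> 'a::real_normed_field^'n^'n"
  assumes "k \<in> {1..K}" "i \<noteq> j"
  shows "(norm ((matrix_inv Q ** A k ** Q) $ i $ j))\<^sup>2 \<le> 2 * offdiag_energy A K Q"
proof -
  let ?e = "\<lambda>k i j. (norm ((matrix_inv Q ** A k ** Q) $ i $ j))\<^sup>2"
  have "?e k i j \<le> (\<Sum>j\<in>UNIV - {i}. ?e k i j)"
    using assms by (intro member_le_sum) auto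
  also have "\<dots> \<le> (\<Sum>i\<in>UNIV. \<Sum>j\<in>UNIV - {i}. ?e k i j)"
    by (rule member_le_sum) (auto intro: sum_nonneg)
  also have "\<dots> \<le> (\<Sum>k=1..K. \<Sum>i\<in>UNIV. \<Sum>j\<in>UNIV - {i}. ?e k i j)"
    using assms
    by (intro member_le_sum[where f = "\<lambda>k. \<Sum>i\<in>UNIV. \<Sum>j\<in>UNIV - {i}. ?e k i j"])
       (auto intro!: sum_nonneg)
  finally show ?thesis
    by (simp add: offdiag_energy_def)
qed


section \<open>Bounded energy near a singular matrix forces an invariant subspace\<close>

lemma Bseq_plus:
  fixes f g :: "nat \<Rightarrow> 'a::real_normed_vector"
  assumes "Bseq f" "Bseq g"
  shows "Bseq (\<lambda>m. f m + g m)"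
proof -
  obtain a b where "\<And>m. norm (f m) \<le> a" "\<And>m. norm (g m) \<le> b"
    using assms by (meson Bseq_def)
  then have "norm (f m + g m) \<le> a + b" for m
    by (meson add_mono norm_triangle_le)
  then show ?thesis
    by (rule BseqI')
qed

lemma Bseq_sum:
  fixes f :: "'i \<Rightarrow> nat \<Rightarrow> 'a::real_normed_vector"
  assumes "\<And>i. i \<in> I \<Longrightarrow> Bseq (f i)"
  shows "Bseq (\<lambda>m. \<Sum>i\<in>I. f i m)"
proof (cases "finite I")
  case True
  then show ?thesis
    using assms
  proof (induction I)
    case empty
    then show ?case by simp
  next
    case (insert i I)
    then have "Bseq (\<lambda>m. f i m + (\<Sum>i\<in>I. f i m))"
      by (intro Bseq_plus) auto
    then show ?case
      using insert.hyps by simp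
  qed
qed simp

text \<open>Row \<open>r\<close> of \<open>Q m ** X m = A ** Q m\<close> can be solved for the diagonal coefficient
  \<open>X m $ j $ j\<close>, because \<open>Q m $ r $ j\<close> has a nonzero limit. So the whole \<open>j\<close>-th column of \<open>X m\<close>
  is bounded, and a subsequential limit of it serves as \<open>b\<close>.\<close>

lemma limit_of_bounded_conjugates:
  fixes A Z :: "'a::{real_normed_field,heine_borel}^'n^'n"
  assumes lim: "Q \<longlonglongrightarrow> Z"
    and eq: "\<And>m. Q m ** X m = A ** Q m"
    and bdd: "\<And>i. i \<noteq> j \<Longrightarrow> Bseq (\<lambda>m. X m $ i $ j)"
    and nz: "Z $ r $ j \<noteq> 0"
  shows "\<exists>b. Z *v b = A *v column j Z"
proof -
  have entry: "(\<lambda>m. Q m $ i $ l) \<longlonglongrightarrow> Z $ i $ l" for i l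
    by (intro tendsto_vec_nth lim)
  have eqc: "(\<Sum>i\<in>UNIV. Q m $ l $ i * X m $ i $ j) = (\<Sum>i\<in>UNIV. A $ l $ i * Q m $ i $ j)" for m l
    using arg_cong[OF eq[of m], of "\<lambda>M. M $ l $ j"] by (simp add: matrix_matrix_mult_component)
  have Bq: "Bseq (\<lambda>m. Q m $ i $ l)" for i l
    using convergent_imp_Bseq[OF convergentI[OF entry]] .
  have "Bseq (\<lambda>m. inverse (Q m $ r $ j) *
      ((\<Sum>i\<in>UNIV. A $ r $ i * Q m $ i $ j) + - (\<Sum>i\<in>UNIV - {j}. Q m $ r $ i * X m $ i $ j)))"
  proof (intro Bseq_mult)
    show "Bseq (\<lambda>m. inverse (Q m $ r $ j))"
      using entry nz by (rule Bfun_inverse)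
    have "Bseq (\<lambda>m. \<Sum>i\<in>UNIV. A $ r $ i * Q m $ i $ j)"
      by (intro Bseq_sum Bseq_mult Bq) auto
    moreover have "Bseq (\<lambda>m. - (\<Sum>i\<in>UNIV - {j}. Q m $ r $ i * X m $ i $ j))"
      unfolding Bseq_minus_iff by (intro Bseq_sum Bseq_mult Bq bdd) auto
    ultimately show "Bseq (\<lambda>m. (\<Sum>i\<in>UNIV. A $ r $ i * Q m $ i $ j)
        + - (\<Sum>i\<in>UNIV - {j}. Q m $ r $ i * X m $ i $ j))"
      by (rule Bseq_plus)
  qed
  moreover have "\<forall>\<^sub>F m in sequentially. X m $ j $ j = inverse (Q m $ r $ j) *
      ((\<Sum>i\<in>UNIV. A $ r $ i * Q m $ i $ j) + - (\<Sum>i\<in>UNIV - {j}. Q m $ r $ i * X m $ i $ j))"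
    using tendsto_imp_eventually_ne[OF entry nz]
  proof eventually_elim
    case (elim m)
    have "(\<Sum>i\<in>UNIV. Q m $ r $ i * X m $ i $ j)
        = Q m $ r $ j * X m $ j $ j + (\<Sum>i\<in>UNIV - {j}. Q m $ r $ i * X m $ i $ j)"
      by (subst sum.remove[of _ j]) auto
    with eqc[of m r] elim show ?case
      by (simp add: field_simps)
  qed
  ultimately have diag: "Bseq (\<lambda>m. X m $ j $ j)"
    by (elim Bseq_eventually_mono[rotated]) (auto elim: eventually_mono)
  have all: "Bseq (\<lambda>m. X m $ i $ j)" for i
    using diag bdd by (cases "i = j") auto
  obtain c where c: "\<And>i m. norm (X m $ i $ j) \<le> c i"
    using all unfolding Bseq_def by metis
  have "norm (column j (X m)) \<le> sum c UNIV" for m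
  proof -
    have "norm (column j (X m)) \<le> (\<Sum>i\<in>UNIV. norm (column j (X m) $ i))"
      unfolding norm_vec_def by (rule L2_set_le_sum) simp
    also have "\<dots> \<le> sum c UNIV"
      by (intro sum_mono) (simp add: column_def c)
    finally show ?thesis .
  qed
  then have "bounded (range (\<lambda>m. column j (X m)))"
    by (auto simp: bounded_iff)
  then obtain b s where s: "strict_mono s" and b: "((\<lambda>m. column j (X m)) \<circ> s) \<longlonglongrightarrow> b"
    using bounded_imp_convergent_subsequence by blast
  have bc: "(\<lambda>m. X (s m) $ i $ j) \<longlonglongrightarrow> b $ i" for i
    using tendsto_vec_nth[OF b, of i] by (simp add: column_def o_def)
  have qc: "(\<lambda>m. Q (s m) $ i $ l) \<longlonglongrightarrow> Z $ i $ l" for i l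
    using LIMSEQ_subseq_LIMSEQ[OF entry s] by (simp add: o_def)
  have "(Z *v b) $ l = (A *v column j Z) $ l" for l
  proof -
    have "(\<lambda>m. \<Sum>i\<in>UNIV. Q (s m) $ l $ i * X (s m) $ i $ j) \<longlonglongrightarrow> (\<Sum>i\<in>UNIV. Z $ l $ i * b $ i)"
      by (intro tendsto_intros bc qc)
    moreover have "(\<lambda>m. \<Sum>i\<in>UNIV. A $ l $ i * Q (s m) $ i $ j)
        \<longlonglongrightarrow> (\<Sum>i\<in>UNIV. A $ l $ i * Z $ i $ j)"
      by (intro tendsto_intros qc)
    ultimately have "(\<Sum>i\<in>UNIV. Z $ l $ i * b $ i) = (\<Sum>i\<in>UNIV. A $ l $ i * Z $ i $ j)"
      unfolding eqc by (rule LIMSEQ_unique)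
    then show ?thesis
      by (simp add: matrix_vector_mult_def column_def)
  qed
  then have "Z *v b = A *v column j Z"
    by (simp add: vec_eq_iff)
  then show ?thesis ..
qed

lemma range_invariant_if_columns:
  fixes A Z :: "'a::field^'n^'n"
  assumes "\<And>j. \<exists>b. Z *v b = A *v column j Z"
  shows "invariant_subspace A (range ((*v) Z))"
proof -
  have sub: "vec.subspace (range ((*v) Z))"
    by (simp add: matrix_vector_mul_linear_gen vec.linear_subspace_image)
  have "A *v (Z *v x) \<in> range ((*v) Z)" for x
  proof -
    have "A *v (Z *v x) = (\<Sum>j\<in>UNIV. x $ j *s (A *v column j Z))"
      by (simp add: matrix_mult_sum[of Z] vec.linear_sum[OF matrix_vector_mul_linear_gen]
          vec.linear_scale[OF matrix_vector_mul_linear_gen])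
    also have "\<dots> \<in> range ((*v) Z)"
      by (intro vec.subspace_sum[OF sub] vec.subspace_scale[OF sub]) (metis assms rangeI)
    finally show ?thesis .
  qed
  with sub show ?thesis
    by (auto simp: invariant_subspace_def)
qed

lemma nontrivial_range:
  fixes Z :: "'a::field^'n^'n"
  assumes "Z \<noteq> 0" "\<not> invertible Z"
  shows "nontrivial_subspace (range ((*v) Z))"
proof -
  have "range ((*v) Z) \<noteq> UNIV"
    using assms(2) matrix_right_invertible_surjective[of Z] by (auto simp: invertible_right_inverse)
  moreover have "range ((*v) Z) \<noteq> {0}"
  proof
    assume "range ((*v) Z) = {0}"
    then have "Z *v x = 0 *v x" for x
      using matrix_vector_mult_0[of x] by (metis rangeI singletonD)
    then show False
      using assms(1) matrix_eq by blast
  qed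
  moreover have "vec.subspace (range ((*v) Z))"
    by (simp add: matrix_vector_mul_linear_gen vec.linear_subspace_image)
  ultimately show ?thesis
    by (simp add: nontrivial_subspace_def)
qed

lemma common_invariant_subspace_if_not_coercive:
  fixes A :: "nat \<Rightarrow> 'a::{real_normed_field,heine_borel}^'n^'n"
  assumes "Z \<noteq> 0" "rank_deficient Z"
    and "\<not> filterlim (offdiag_energy A K) at_top (at Z within GL)"
  shows "\<exists>M. nontrivial_subspace M \<and> (\<forall>k\<in>{1..K}. invariant_subspace (A k) M)"
proof -
  obtain C where C: "\<not> (\<forall>\<^sub>F Q in at Z within GL. C \<le> offdiag_energy A K Q)"
    using assms(3) by (auto simp: filterlim_at_top)
  have "\<exists>Q\<in>GL. dist Q Z < 1 / Suc m \<and> offdiag_energy A K Q < C" for m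
    using C by (simp add: eventually_at not_le) (metis divide_pos_pos of_nat_0_less_iff zero_less_Suc
        zero_less_one of_nat_Suc)
  then obtain Q where Q: "\<And>m. Q m \<in> GL" "\<And>m. dist (Q m) Z < 1 / Suc m"
      "\<And>m. offdiag_energy A K (Q m) < C"
    by metis
  have lim: "Q \<longlonglongrightarrow> Z"
  proof (rule metric_tendsto_imp_tendsto[OF LIMSEQ_inverse_real_of_nat])
    show "\<forall>\<^sub>F m in sequentially. dist (Q m) Z \<le> dist (inverse (real (Suc m))) 0"
      using Q(2) by (auto simp: inverse_eq_divide less_imp_le)
  qed
  have "invariant_subspace (A k) (range ((*v) Z))" if k: "k \<in> {1..K}" for k
  proof (rule range_invariant_if_columns)
    fix j
    show "\<exists>b. Z *v b = A k *v column j Z"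
    proof (cases "column j Z = 0")
      case True
      then show ?thesis
        by (metis matrix_vector_mult_0_right)
    next
      case False
      then obtain r where "Z $ r $ j \<noteq> 0"
        by (auto simp: column_def vec_eq_iff)
      moreover have "Q m ** (matrix_inv (Q m) ** A k ** Q m) = A k ** Q m" for m
        using Q(1)[of m] by (intro matrix_mul_conjugate) (simp add: GL_def)
      moreover have "Bseq (\<lambda>m. (matrix_inv (Q m) ** A k ** Q m) $ i $ j)" if "i \<noteq> j" for i
      proof (rule BseqI')
        fix m
        have "(norm ((matrix_inv (Q m) ** A k ** Q m) $ i $ j))\<^sup>2 \<le> 2 * C"
          using offdiag_entry_le_energy[OF k that, of "Q m" A] Q(3)[of m] by linarith
        then show "norm ((matrix_inv (Q m) ** A k ** Q m) $ i $ j) \<le> sqrt (2 * C)"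
          by (rule real_le_rsqrt)
      qed
      ultimately show ?thesis
        using lim by (intro limit_of_bounded_conjugates)
    qed
  qed
  moreover have "nontrivial_subspace (range ((*v) Z))"
    using assms(1,2) by (intro nontrivial_range) (auto simp: rank_deficient_iff_not_invertible)
  ultimately show ?thesis by blast
qed


section \<open>An invariant subspace yields an approach of bounded energy\<close>

text \<open>A basis of \<open>M\<close>, extended to a basis of the whole space and arranged as the columns of
  \<open>P\<close>, turns \<open>M\<close> into a coordinate subspace; \<open>S\<close> is the set of indices of those columns that lie in \<open>M\<close>.\<close>

lemma adapted_basis_matrix:
  fixes M :: "('a::field^'n) set"
  assumes "vec.subspace M"
  obtains P :: "'a^'n^'n" and S where "invertible P"
    and "\<And>x. P *v x \<in> M \<longleftrightarrow> (\<forall>i. i \<notin> S \<longrightarrow> x $ i = 0)"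
proof -
  obtain B where B: "B \<subseteq> M" "vec.independent B" "M \<subseteq> vec.span B"
    using vec.basis_exists[of M] by metis
  have spanB: "vec.span B = M"
    using B assms by (meson subset_antisym vec.span_minimal)
  let ?E = "vec.extend_basis B"
  have E: "B \<subseteq> ?E" "vec.independent ?E" "vec.span ?E = UNIV"
    using vec.extend_basis_superset[OF B(2)] vec.independent_extend_basis[OF B(2)]
      vec.span_extend_basis[OF B(2)] .
  have "card ?E = CARD('n)"
    using vec.dim_eq_card[of ?E UNIV] E(2,3)
    unfolding vec_dim_card vec.span_UNIV by metis
  moreover have "finite ?E"
    using E(2) by (rule vec.finiteI_independent)
  ultimately obtain f :: "'n \<Rightarrow> 'a^'n" where f: "bij_betw f UNIV ?E"
    using finite_same_card_bij[of "UNIV :: 'n set" ?E] by auto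
  define P :: "'a^'n^'n" where "P = (\<chi> r i. f i $ r)"
  have col: "column i P = f i" for i
    by (simp add: P_def column_def vec_eq_iff)
  have "columns P = ?E"
    using f by (auto simp: columns_def col bij_betw_def)
  then have P: "invertible P"
    by (simp add: invertible_right_inverse matrix_right_invertible_span_columns E(3))
  define S where "S = f -` B"
  have fS: "f ` S = B" "inj_on f S"
    using f E(1) by (auto simp: S_def bij_betw_def inj_on_def)
  have "P *v x \<in> M \<longleftrightarrow> (\<forall>i. i \<notin> S \<longrightarrow> x $ i = 0)" for x
  proof
    assume "\<forall>i. i \<notin> S \<longrightarrow> x $ i = 0"
    then have "x $ i *s f i \<in> M" for i
      using B(1) assms by (cases "i \<in> S") (auto simp: S_def vec.subspace_scale vec.subspace_0)
    then show "P *v x \<in> M"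
      by (simp add: matrix_mult_sum col vec.subspace_sum[OF assms])
  next
    assume "P *v x \<in> M"
    then have "P *v x \<in> range (\<lambda>u. \<Sum>v\<in>B. u v *s v)"
      using spanB vec.span_finite[OF vec.finiteI_independent[OF B(2)]] by auto
    then obtain u where u: "P *v x = (\<Sum>v\<in>B. u v *s v)"
      by blast
    define y :: "'a^'n" where "y = (\<chi> i. if i \<in> S then u (f i) else 0)"
    have "P *v y = (\<Sum>i\<in>UNIV. if i \<in> S then u (f i) *s f i else 0)"
      unfolding matrix_mult_sum col y_def by (rule sum.cong) auto
    also have "\<dots> = (\<Sum>i\<in>S. u (f i) *s f i)"
      by (simp add: sum.If_cases)
    also have "\<dots> = (\<Sum>v\<in>B. u v *s v)"
      using sum.reindex[OF fS(2), of "\<lambda>v. u v *s v"] fS(1) by simp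
    finally have "P *v y = P *v x"
      using u by simp
    then have "y = x"
      using P by (metis invertible_eq_bij bij_is_inj injD)
    then show "\<forall>i. i \<notin> S \<longrightarrow> x $ i = 0"
      by (auto simp: y_def)
  qed
  with P show ?thesis by (rule that)
qed

definition scaling_outside :: "'n set \<Rightarrow> 'a \<Rightarrow> 'a::field^'n^'n" where
  "scaling_outside S t = (\<chi> i j. if i = j then if i \<in> S then 1 else t else 0)"

lemma scaling_outside_mult_left:
  "(scaling_outside S t ** X) $ i $ j = (if i \<in> S then 1 else t) * X $ i $ j"
  by (simp add: matrix_matrix_mult_component scaling_outside_def if_distrib[of "\<lambda>c. c * _"] cong: if_cong)

lemma scaling_outside_mult_right:
  "(X ** scaling_outside S t) $ i $ j = X $ i $ j * (if j \<in> S then 1 else t)"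
  by (simp add: matrix_matrix_mult_component scaling_outside_def if_distrib[of "\<lambda>c. _ * c"] cong: if_cong)

lemma invertible_scaling_outside:
  assumes "t \<noteq> 0"
  shows "invertible (scaling_outside S t)"
proof -
  have "scaling_outside S (inverse t) ** scaling_outside S t = mat 1"
    using assms
    by (simp add: vec_eq_iff scaling_outside_mult_left) (simp add: scaling_outside_def mat_def)
  then show ?thesis
    by (auto simp: invertible_left_inverse)
qed

text \<open>With \<open>d\<^sub>i\<close> the diagonal entries of the scaling and \<open>C\<close> the conjugate by \<open>P\<close>, the new
  conjugate has the entries \<open>d\<^sub>i\<inverse> C\<^sub>i\<^sub>j d\<^sub>j\<close>. The factor \<open>d\<^sub>i\<inverse> d\<^sub>j\<close> can exceed \<open>1\<close> in norm only for
  \<open>i \<notin> S\<close>, \<open>j \<in> S\<close>, where invariance of the subspace makes \<open>C\<^sub>i\<^sub>j\<close> vanish.\<close>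

lemma scaled_conjugate_entry_le:
  fixes A P :: "'a::real_normed_field^'n^'n"
  assumes P: "invertible P"
    and M: "\<And>x. P *v x \<in> M \<longleftrightarrow> (\<forall>i. i \<notin> S \<longrightarrow> x $ i = 0)"
    and inv: "invariant_subspace A M"
    and t: "t \<noteq> 0" "norm t \<le> 1"
  defines "Q \<equiv> P ** scaling_outside S t"
  shows "norm ((matrix_inv Q ** A ** Q) $ i $ j) \<le> norm ((matrix_inv P ** A ** P) $ i $ j)"
proof -
  let ?D = "scaling_outside S t :: 'a^'n^'n"
  let ?C = "matrix_inv P ** A ** P" and ?X = "matrix_inv Q ** A ** Q"
  have "invertible Q"
    unfolding Q_def by (intro invertible_mult P invertible_scaling_outside t)
  then have eq: "P ** (?D ** ?X) = P ** (?C ** ?D)"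
    using matrix_mul_conjugate[of Q A] matrix_mul_conjugate[OF P, of A]
    by (simp add: Q_def matrix_mul_assoc)
  obtain P' where P': "P' ** P = mat 1"
    using P by (auto simp: invertible_left_inverse)
  have "?D ** ?X = ?C ** ?D"
    using arg_cong[OF eq, of "(**) P'"] unfolding matrix_mul_assoc[of P' P] P' matrix_mul_lid .
  then have "(?D ** ?X) $ i $ j = (?C ** ?D) $ i $ j"
    by simp
  then have entry: "(if i \<in> S then 1 else t) * ?X $ i $ j = ?C $ i $ j * (if j \<in> S then 1 else t)"
    unfolding scaling_outside_mult_left scaling_outside_mult_right .
  have zero: "?C $ i $ j = 0" if "i \<notin> S" "j \<in> S"
  proof -
    have "P *v axis j 1 \<in> M"
      using that(2) unfolding M by (auto simp: axis_def)
    then have "A *v (P *v axis j 1) \<in> M"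
      using inv by (auto simp: invariant_subspace_def)
    then have "P *v (?C *v axis j 1) \<in> M"
      using matrix_mul_conjugate[OF P, of A] by (simp add: matrix_vector_mul_assoc)
    then have "(?C *v axis j 1) $ i = 0"
      using that(1) unfolding M by blast
    then show ?thesis
      by (simp add: matrix_vector_mult_def axis_def if_distrib[of "\<lambda>c. _ * c"] cong: if_cong)
  qed
  consider "i \<in> S \<longleftrightarrow> j \<in> S" | "i \<in> S" "j \<notin> S" | "i \<notin> S" "j \<in> S" by blast
  then show ?thesis
  proof cases
    case 1
    then have "?X $ i $ j = ?C $ i $ j"
      using entry t(1) by (auto split: if_splits)
    then show ?thesis by simp
  next
    case 2
    then have "?X $ i $ j = ?C $ i $ j * t"
      using entry by simp
    then show ?thesis
      using t(2) by (simp add: norm_mult mult_left_le)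
  next
    case 3
    then show ?thesis
      using entry zero t(1) by simp
  qed
qed

lemma offdiag_energy_mono:
  assumes "\<And>k i j. k \<in> {1..K} \<Longrightarrow>
    norm ((matrix_inv Q ** A k ** Q) $ i $ j) \<le> norm ((matrix_inv P ** A k ** P) $ i $ j)"
  shows "offdiag_energy A K Q \<le> offdiag_energy A K P"
  unfolding offdiag_energy_def using assms
  by (intro mult_left_mono sum_mono power_mono) auto

lemma not_coercive_if_common_invariant_subspace:
  fixes A :: "nat \<Rightarrow> 'a::real_normed_field^'n^'n"
  assumes M: "nontrivial_subspace M"
    and inv: "\<And>k. k \<in> {1..K} \<Longrightarrow> invariant_subspace (A k) M"
  shows "\<exists>Z. Z \<noteq> 0 \<and> rank_deficient Z
    \<and> \<not> filterlim (offdiag_energy A K) at_top (at Z within GL)"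
proof -
  obtain P :: "'a^'n^'n" and S where P: "invertible P"
    and PM: "\<And>x. P *v x \<in> M \<longleftrightarrow> (\<forall>i. i \<notin> S \<longrightarrow> x $ i = 0)"
    using M adapted_basis_matrix[of M] unfolding nontrivial_subspace_def by metis
  have bij: "bij ((*v) P)"
    using P by (simp add: invertible_eq_bij)
  have surj: "\<exists>x. y = P *v x" for y
    using bij_is_surj[OF bij] by (rule surjD)
  define R where "R t = P ** scaling_outside S t" for t :: 'a
  have Rcomp: "R t $ i $ j = P $ i $ j * (if j \<in> S then 1 else t)" for t i j
    by (simp add: R_def scaling_outside_mult_right)
  have invR: "invertible (R t)" if "t \<noteq> 0" for t
    unfolding R_def by (intro invertible_mult P invertible_scaling_outside that)
  obtain s where s: "s \<in> S"
  proof -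
    have "S \<noteq> {}"
    proof
      assume S: "S = {}"
      have "y = 0" if "y \<in> M" for y
      proof -
        obtain x where x: "y = P *v x"
          using surj by blast
        with that PM[of x] S have "x = 0"
          by (simp add: vec_eq_iff)
        with x show ?thesis by simp
      qed
      then show False
        using M vec.subspace_0[of M] by (auto simp: nontrivial_subspace_def)
    qed
    then show ?thesis using that by blast
  qed
  obtain q where q: "q \<notin> S"
  proof -
    have "S \<noteq> UNIV"
    proof
      assume "S = UNIV"
      then have "P *v x \<in> M" for x
        using PM by simp
      then have "y \<in> M" for y
        using surj by metis
      then show False
        using M by (auto simp: nontrivial_subspace_def)
    qed
    then show ?thesis using that by blast
  qed
  have nz: "R 0 \<noteq> 0"
  proof
    assume "R 0 = 0"
    then have "column s P = 0"
      using s Rcomp[of 0 _ s] by (simp add: column_def vec_eq_iff)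
    then have "P *v axis s 1 = P *v 0"
      by (simp add: column_def vec_eq_iff matrix_vector_mult_def axis_def
          if_distrib[of "\<lambda>c. _ * c"] cong: if_cong)
    then have "(axis s 1 :: 'a^'n) = 0"
      using bij_is_inj[OF bij] by (metis injD)
    then show False
      by (metis axis_eq_0_iff zero_neq_one)
  qed
  have sing: "\<not> invertible (R 0)"
  proof
    assume "invertible (R 0)"
    then have "inj ((*v) (R 0))"
      by (simp add: invertible_eq_bij bij_is_inj)
    moreover have "R 0 *v axis q 1 = R 0 *v 0"
      using q by (simp add: vec_eq_iff matrix_vector_mult_def axis_def Rcomp
          if_distrib[of "\<lambda>c. _ * c"] cong: if_cong)
    ultimately have "(axis q 1 :: 'a^'n) = 0"
      by (metis injD)
    then show False
      by (metis axis_eq_0_iff zero_neq_one)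
  qed
  define t :: "nat \<Rightarrow> 'a" where "t m = of_real (inverse (real (Suc m)))" for m
  have t0: "t m \<noteq> 0" and t1: "norm (t m) \<le> 1" for m
    unfolding t_def norm_of_real by (simp_all add: divide_simps del: of_real_inverse of_nat_Suc)
  have tlim: "t \<longlonglongrightarrow> 0"
    unfolding t_def using tendsto_of_real[OF LIMSEQ_inverse_real_of_nat, where 'a = 'a] by simp
  have "(\<lambda>m. R (t m)) \<longlonglongrightarrow> R 0"
  proof (intro vec_tendstoI)
    fix i j
    have "(\<lambda>m. P $ i $ j * (if j \<in> S then 1 else t m)) \<longlonglongrightarrow> P $ i $ j * (if j \<in> S then 1 else 0)"
      by (cases "j \<in> S") (auto intro!: tendsto_eq_intros tlim)
    then show "(\<lambda>m. R (t m) $ i $ j) \<longlonglongrightarrow> R 0 $ i $ j"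
      by (simp only: Rcomp)
  qed
  moreover have "R (t m) \<in> GL - {R 0}" for m
    using invR[OF t0[of m]] sing by (auto simp: GL_def)
  ultimately have approach: "filterlim (\<lambda>m. R (t m)) (at (R 0) within GL) sequentially"
    by (auto simp: filterlim_at)
  have bound: "offdiag_energy A K (R (t m)) \<le> offdiag_energy A K P" for m
    unfolding R_def
    by (intro offdiag_energy_mono scaled_conjugate_entry_le[OF P PM inv t0 t1])
  have "\<not> filterlim (offdiag_energy A K) at_top (at (R 0) within GL)"
  proof
    assume "filterlim (offdiag_energy A K) at_top (at (R 0) within GL)"
    then have "filterlim (\<lambda>m. offdiag_energy A K (R (t m))) at_top sequentially"
      using approach by (rule filterlim_compose)
    then have "\<forall>\<^sub>F m in sequentially. offdiag_energy A K P < offdiag_energy A K (R (t m))"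
      by (simp add: filterlim_at_top_dense)
    then obtain m where "offdiag_energy A K P < offdiag_energy A K (R (t m))"
      by (metis eventually_happens' sequentially_bot)
    with bound[of m] show False by simp
  qed
  with nz sing show ?thesis
    by (auto simp: rank_deficient_iff_not_invertible)
qed


section \<open>The equivalence\<close>

lemma coercive_iff_no_common_invariant_subspace:
  fixes A :: "nat \<Rightarrow> 'a::{real_normed_field,heine_borel}^'n^'n"
  shows "(\<forall>Z. Z \<noteq> 0 \<longrightarrow> rank_deficient Z \<longrightarrow>
            filterlim (offdiag_energy A K) at_top (at Z within GL))
    \<longleftrightarrow> \<not> (\<exists>M. nontrivial_subspace M \<and> (\<forall>k\<in>{1..K}. invariant_subspace (A k) M))"
    (is "?coercive \<longleftrightarrow> \<not> ?reducible")
proof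
  assume c: ?coercive
  show "\<not> ?reducible"
  proof
    assume ?reducible
    then obtain M where "nontrivial_subspace M" "\<And>k. k \<in> {1..K} \<Longrightarrow> invariant_subspace (A k) M"
      by auto
    then obtain Z where "Z \<noteq> 0" "rank_deficient Z"
        and "\<not> filterlim (offdiag_energy A K) at_top (at Z within GL)"
      using not_coercive_if_common_invariant_subspace[of M K A] by auto
    with c show False
      by simp
  qed
next
  assume r: "\<not> ?reducible"
  show ?coercive
  proof (intro allI impI)
    fix Z :: "'a^'n^'n"
    assume "Z \<noteq> 0" "rank_deficient Z"
    then show "filterlim (offdiag_energy A K) at_top (at Z within GL)"
      using common_invariant_subspace_if_not_coercive[of Z A K] r by argo
  qed
qed

theorem theorem2p1:
  fixes A :: "nat \<Rightarrow> real^'n^'n" and B :: "nat \<Rightarrow> complex^'n^'n" and K :: nat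
  shows "((\<forall>Z::real^'n^'n. Z \<noteq> 0 \<longrightarrow> rank_deficient Z \<longrightarrow>
              filterlim (offdiag_energy A K) at_top (at Z within GL))
          \<longleftrightarrow> \<not> (\<exists>M. nontrivial_subspace M \<and> (\<forall>k\<in>{1..K}. invariant_subspace (A k) M)))
       \<and> ((\<forall>Z::complex^'n^'n. Z \<noteq> 0 \<longrightarrow> rank_deficient Z \<longrightarrow>
              filterlim (offdiag_energy B K) at_top (at Z within GL))
          \<longleftrightarrow> \<not> (\<exists>M. nontrivial_subspace M \<and> (\<forall>k\<in>{1..K}. invariant_subspace (B k) M)))"
  by (intro conjI coercive_iff_no_common_invariant_subspace)

end
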